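(* There exist an exponentially stable analytic semigroup $(T(t))_{t\ge 0}$ on a Hilbert space $H$, with generator $-A$, a scalar-valued observation operator $C\in B(D(A),\mathbb{C})$, and an element $x\in H$ such that, for every $q\in[1,\infty)$ and every $\tau>0$, the function $t\mapsto CT(t)x$ does not belong to $L^{2,q}(0,\tau)$.
   Context: A semigroup $(T(t))_{t\ge 0}$ here is a strongly continuous semigroup of bounded linear operators; it is exponentially stable if there are $M\ge 1$, $\omega>0$ with $\|T(t)\|\le Me^{-\omega t}$ for all $t\ge 0$. $D(A)$ carries the graph norm of $A$, and $B(D(A),\mathbb{C})$ denotes the bounded linear functionals on it; a scalar-valued observation operator is an element of $B(D(A),\mathbb{C})$. Since the semigroup is analytic, $T(t)H\subset D(A)$ for $t>0$, so $CT(t)x$ is defined for all $x\in H$ and $t>0$. For a measurable function $f$ on a measure space $(\Omega,\mu)$ let $d_f(\alpha)=\mu(\{\omega\in\Omega : |f(\omega)|>\alpha\})$ and let $f^*(t)=\inf\{s>0 : d_f(s)\le t\}$ be its rearrangement. For $1\le q<\infty$ the Lorentz space $L^{2,q}(\Omega)$ is the set of measurable functions $f:\Omega\to\mathbb{C}$ for which $$\|f\|_{L^{2,q}(\Omega)}=\left(\int_0^\infty \bigl(t^{1/2} f^*(t)\bigr)^q\,\frac{dt}{t}\right)^{1/q}$$ is finite. $L^{2,q}(0,\tau)$ is the case $\Omega=(0,\tau)$ with Lebesgue measure. *)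

theory Defs
  imports "HOL-Analysis.Analysis" "HOL-Algebra.Module" "HOL-Algebra.Algebraic_Closure_Type"
begin

section \<open>Complex Hilbert spaces\<close>

text \<open>
  Hilbert spaces are structures with an explicit carrier, so that one can assert the existence
  of a Hilbert space. The \<open>mult\<close> and \<open>one\<close> fields inherited from \<^typ>\<open>('c, 'a) module\<close> are
  not used. The scalar product is linear in its first argument.
\<close>

record 'a hilbert_space = "(complex, 'a) module" +
  hinner :: "'a \<Rightarrow> 'a \<Rightarrow> complex"

definition hnorm :: "'a hilbert_space \<Rightarrow> 'a \<Rightarrow> real" where
  "hnorm H x = sqrt (Re (hinner H x x))"

definition hdist :: "'a hilbert_space \<Rightarrow> 'a \<Rightarrow> 'a \<Rightarrow> real" where
  "hdist H x y = hnorm H (x \<ominus>\<^bsub>H\<^esub> y)"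

locale complex_hilbert_space = module "ring_of_type_algebra :: complex ring" H
  for H :: "'a hilbert_space" (structure) +
  assumes hinner_add:
      "\<lbrakk>x \<in> carrier H; y \<in> carrier H; z \<in> carrier H\<rbrakk> \<Longrightarrow>
        hinner H (x \<oplus> y) z = hinner H x z + hinner H y z"
    and hinner_smult:
      "\<lbrakk>x \<in> carrier H; y \<in> carrier H\<rbrakk> \<Longrightarrow> hinner H (c \<odot> x) y = c * hinner H x y"
    and hinner_cnj:
      "\<lbrakk>x \<in> carrier H; y \<in> carrier H\<rbrakk> \<Longrightarrow> hinner H y x = cnj (hinner H x y)"
    and hinner_nonneg: "x \<in> carrier H \<Longrightarrow> 0 \<le> Re (hinner H x x)"
    and hinner_eq_0: "\<lbrakk>x \<in> carrier H; hinner H x x = 0\<rbrakk> \<Longrightarrow> x = \<zero>"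
    and complete: "Metric_space.mcomplete (carrier H) (hdist H)"

definition hlim :: "'a hilbert_space \<Rightarrow> ('b \<Rightarrow> 'a) \<Rightarrow> 'a \<Rightarrow> 'b filter \<Rightarrow> bool" where
  "hlim H f l F \<longleftrightarrow> ((\<lambda>s. hdist H (f s) l) \<longlongrightarrow> 0) F"


section \<open>Bounded operators\<close>

definition bounded_operator :: "'a hilbert_space \<Rightarrow> ('a \<Rightarrow> 'a) \<Rightarrow> bool" where
  "bounded_operator H S \<longleftrightarrow>
     S \<in> carrier H \<rightarrow> carrier H \<and>
     (\<forall>x\<in>carrier H. \<forall>y\<in>carrier H. S (x \<oplus>\<^bsub>H\<^esub> y) = S x \<oplus>\<^bsub>H\<^esub> S y) \<and>
     (\<forall>c. \<forall>x\<in>carrier H. S (c \<odot>\<^bsub>H\<^esub> x) = c \<odot>\<^bsub>H\<^esub> S x) \<and>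
     (\<exists>K. \<forall>x\<in>carrier H. hnorm H (S x) \<le> K * hnorm H x)"

text \<open>Only meaningful for bounded operators, since \<^const>\<open>Sup\<close> on the reals is total.\<close>

definition op_norm :: "'a hilbert_space \<Rightarrow> ('a \<Rightarrow> 'a) \<Rightarrow> real" where
  "op_norm H S = (SUP x\<in>{x \<in> carrier H. hnorm H x \<le> 1}. hnorm H (S x))"


section \<open>Semigroups and generators\<close>

definition C0_semigroup :: "'a hilbert_space \<Rightarrow> (real \<Rightarrow> 'a \<Rightarrow> 'a) \<Rightarrow> bool" where
  "C0_semigroup H T \<longleftrightarrow>
     (\<forall>t\<ge>0. bounded_operator H (T t)) \<and>
     (\<forall>x\<in>carrier H. T 0 x = x) \<and>
     (\<forall>s\<ge>0. \<forall>t\<ge>0. \<forall>x\<in>carrier H. T (s + t) x = T s (T t x)) \<and>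
     (\<forall>x\<in>carrier H. hlim H (\<lambda>t. T t x) x (at_right 0))"

definition exponentially_stable :: "'a hilbert_space \<Rightarrow> (real \<Rightarrow> 'a \<Rightarrow> 'a) \<Rightarrow> bool" where
  "exponentially_stable H T \<longleftrightarrow>
     (\<exists>M\<ge>1. \<exists>\<omega>>0. \<forall>t\<ge>0. op_norm H (T t) \<le> M * exp (- \<omega> * t))"

definition difference_quotient ::
    "'a hilbert_space \<Rightarrow> (real \<Rightarrow> 'a \<Rightarrow> 'a) \<Rightarrow> 'a \<Rightarrow> real \<Rightarrow> 'a" where
  "difference_quotient H T x t = complex_of_real (1 / t) \<odot>\<^bsub>H\<^esub> (T t x \<ominus>\<^bsub>H\<^esub> x)"

text \<open>
  The unbounded operator \<open>G\<close> with domain \<open>D\<close> is the generator of \<open>T\<close>;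
  the values of \<open>G\<close> outside \<open>D\<close> are irrelevant.
\<close>

definition is_generator ::
    "'a hilbert_space \<Rightarrow> (real \<Rightarrow> 'a \<Rightarrow> 'a) \<Rightarrow> 'a set \<Rightarrow> ('a \<Rightarrow> 'a) \<Rightarrow> bool" where
  "is_generator H T D G \<longleftrightarrow>
     D = {x \<in> carrier H. \<exists>y\<in>carrier H. hlim H (difference_quotient H T x) y (at_right 0)} \<and>
     (\<forall>x\<in>D. G x \<in> carrier H \<and> hlim H (difference_quotient H T x) (G x) (at_right 0))"

definition sector :: "real \<Rightarrow> complex set" where
  "sector \<delta> = {z. z \<noteq> 0 \<and> \<bar>Arg z\<bar> < \<delta>}"

definition op_holomorphic_on ::
    "'a hilbert_space \<Rightarrow> (complex \<Rightarrow> 'a \<Rightarrow> 'a) \<Rightarrow> complex set \<Rightarrow> bool" where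
  "op_holomorphic_on H S U \<longleftrightarrow>
     (\<forall>z\<in>U. \<exists>L. bounded_operator H L \<and>
        ((\<lambda>h. op_norm H (\<lambda>x. ((1 / h) \<odot>\<^bsub>H\<^esub> (S (z + h) x \<ominus>\<^bsub>H\<^esub> S z x)) \<ominus>\<^bsub>H\<^esub> L x)) \<longlongrightarrow> 0) (at 0))"

text \<open>
  \<open>T\<close> extends to a holomorphic semigroup on some sector of half-angle \<open>\<delta>\<close> which is
  strongly continuous at 0 on every smaller sector.
\<close>

definition analytic_semigroup :: "'a hilbert_space \<Rightarrow> (real \<Rightarrow> 'a \<Rightarrow> 'a) \<Rightarrow> bool" where
  "analytic_semigroup H T \<longleftrightarrow>
     C0_semigroup H T \<and>
     (\<exists>\<delta> S. 0 < \<delta> \<and> \<delta> \<le> pi / 2 \<and>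
        (\<forall>t\<ge>0. \<forall>x\<in>carrier H. S (complex_of_real t) x = T t x) \<and>
        (\<forall>z\<in>sector \<delta>. bounded_operator H (S z)) \<and>
        (\<forall>z\<in>sector \<delta>. \<forall>w\<in>sector \<delta>. \<forall>x\<in>carrier H. S (z + w) x = S z (S w x)) \<and>
        op_holomorphic_on H S (sector \<delta>) \<and>
        (\<forall>\<delta>'. 0 < \<delta>' \<and> \<delta>' < \<delta> \<longrightarrow>
           (\<forall>x\<in>carrier H. hlim H (\<lambda>z. S z x) x (at 0 within sector \<delta>'))))"

text \<open>
  Bounded linear functionals on \<open>D\<close> with the graph norm of \<open>A\<close>;
  the values of \<open>C\<close> outside \<open>D\<close> are irrelevant.
\<close>

definition observation_functional ::
    "'a hilbert_space \<Rightarrow> 'a set \<Rightarrow> ('a \<Rightarrow> 'a) \<Rightarrow> ('a \<Rightarrow> complex) \<Rightarrow> bool" where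
  "observation_functional H D A C \<longleftrightarrow>
     (\<forall>x\<in>D. \<forall>y\<in>D. C (x \<oplus>\<^bsub>H\<^esub> y) = C x + C y) \<and>
     (\<forall>c. \<forall>x\<in>D. C (c \<odot>\<^bsub>H\<^esub> x) = c * C x) \<and>
     (\<exists>K. \<forall>x\<in>D. cmod (C x) \<le> K * (hnorm H x + hnorm H (A x)))"


section \<open>Lorentz spaces\<close>

definition distribution_function :: "'b measure \<Rightarrow> ('b \<Rightarrow> complex) \<Rightarrow> real \<Rightarrow> ennreal" where
  "distribution_function M f \<alpha> = emeasure M {\<omega> \<in> space M. cmod (f \<omega>) > \<alpha>}"

text \<open>The infimum of the empty set is \<open>\<infinity>\<close>.\<close>

definition rearrangement :: "'b measure \<Rightarrow> ('b \<Rightarrow> complex) \<Rightarrow> real \<Rightarrow> ennreal" where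
  "rearrangement M f t = Inf {ennreal s |s. s > 0 \<and> distribution_function M f s \<le> ennreal t}"

text \<open>The power \<open>x\<^sup>p\<close> for exponents \<open>p > 0\<close>, with \<open>\<infinity>\<^sup>p = \<infinity>\<close>.\<close>

definition ennpowr :: "ennreal \<Rightarrow> real \<Rightarrow> ennreal" where
  "ennpowr x p = (if x = \<infinity> then \<infinity> else ennreal (enn2real x powr p))"

definition lorentz2_norm :: "'b measure \<Rightarrow> real \<Rightarrow> ('b \<Rightarrow> complex) \<Rightarrow> ennreal" where
  "lorentz2_norm M q f =
     ennpowr
       (\<integral>\<^sup>+t\<in>{0<..}. ennpowr (ennreal (t powr (1/2)) * rearrangement M f t) q / ennreal t \<partial>lborel)
       (1 / q)"

definition lorentz2 :: "'b measure \<Rightarrow> real \<Rightarrow> ('b \<Rightarrow> complex) set" where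
  "lorentz2 M q = {f \<in> borel_measurable M. lorentz2_norm M q f < \<infinity>}"

end

theory Submission
  imports Defs
begin

text \<open>
  Let $A$ be the diagonal operator with eigenvalues $16^n$ on the square summable sequences,
  $C$ the functional with coefficients $8^n$ and $x = (2^{-n})_n$. Since
  $8^n = 2^{-n} 16^n$ and $(2^{-n})_n$ is square summable, $C$ is bounded on $D(A)$. Then
  $C T(t) x = \sum_n 4^n e^{-16^n t}$, and the term with $16^n \<le> 1/t < 16^{n+1}$
  alone is at least $c t^{-1/2}$. Hence $t^{1/2} f^*(t) \<ge> c$ near 0 for the rearrangement
  of $f(t) = C T(t) x$, and the integral of $c^q/t$ at 0 diverges for every $q$.
\<close>

section \<open>The sequence space\<close>

definition l2_set :: "(nat \<Rightarrow> complex) set" where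
  "l2_set = {x. summable (\<lambda>n. (cmod (x n))\<^sup>2)}"

text \<open>
  The locale \<^locale>\<open>Metric_space\<close> demands symmetry and nonnegativity of the distance for all
  arguments, also outside the carrier. Replacing sequences that are not square summable by 0
  in the addition makes \<^const>\<open>hdist\<close> a pseudometric on the whole type.
\<close>

definition l2_cut :: "(nat \<Rightarrow> complex) \<Rightarrow> nat \<Rightarrow> complex" where
  "l2_cut x = (if x \<in> l2_set then x else (\<lambda>n. 0))"

definition l2 :: "(nat \<Rightarrow> complex) hilbert_space" where
  "l2 = \<lparr>carrier = l2_set, mult = undefined, one = undefined, zero = (\<lambda>n. 0),
     add = (\<lambda>x y n. l2_cut x n + l2_cut y n), smult = (\<lambda>c x n. c * x n),
     hinner = (\<lambda>x y. \<Sum>n. x n * cnj (y n))\<rparr>"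

lemma carrier_l2 [simp]: "carrier l2 = l2_set"
  and zero_l2 [simp]: "\<zero>\<^bsub>l2\<^esub> = (\<lambda>n. 0)"
  and smult_l2 [simp]: "c \<odot>\<^bsub>l2\<^esub> x = (\<lambda>n. c * x n)"
  and hinner_l2: "hinner l2 x y = (\<Sum>n. x n * cnj (y n))"
  by (simp_all add: l2_def)

lemma l2_cut [simp]: "x \<in> l2_set \<Longrightarrow> l2_cut x = x"
  by (simp add: l2_cut_def)

lemma add_l2 [simp]:
  "x \<in> l2_set \<Longrightarrow> y \<in> l2_set \<Longrightarrow> x \<oplus>\<^bsub>l2\<^esub> y = (\<lambda>n. x n + y n)"
  by (simp add: l2_def)

section \<open>The norm and its finite sections\<close>

lemma hnorm_l2: "hnorm l2 x = sqrt (Re (\<Sum>n. complex_of_real ((cmod (x n))\<^sup>2)))"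
  by (simp only: hnorm_def hinner_l2 complex_norm_square)

lemma hnorm_l2_eq:
  assumes "x \<in> l2_set" shows "hnorm l2 x = sqrt (\<Sum>n. (cmod (x n))\<^sup>2)"
  using assms by (simp only: hnorm_l2 l2_set_def mem_Collect_eq suminf_of_real[symmetric] Re_complex_of_real)

lemma hnorm_l2_nonneg: "x \<in> l2_set \<Longrightarrow> 0 \<le> hnorm l2 x"
  by (simp add: hnorm_l2_eq l2_set_def suminf_nonneg)

lemma L2_set_le_hnorm:
  assumes "x \<in> l2_set" shows "L2_set (\<lambda>n. cmod (x n)) {..<N} \<le> hnorm l2 x"
  unfolding L2_set_def hnorm_l2_eq[OF assms]
  using assms by (auto simp: l2_set_def intro!: sum_le_suminf)

text \<open>Converse of \<open>L2_set_le_hnorm\<close>. Together they reduce estimates in the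
  sequence space to finite sections: an inequality for \<open>L2_set\<close> with a bound
  independent of N yields membership and the norm bound at once.\<close>

lemma l2_boundI:
  assumes "\<And>N. L2_set (\<lambda>n. cmod (x n)) {..<N} \<le> K"
  shows "x \<in> l2_set" "hnorm l2 x \<le> K"
proof -
  have K: "0 \<le> K" using assms[of 0] by simp
  have b: "(\<Sum>n<N. (cmod (x n))\<^sup>2) \<le> K\<^sup>2" for N
    using assms[of N] K unfolding L2_set_def by (metis real_sqrt_le_iff real_sqrt_unique)
  \<comment> \<open>\<open>bounded_imp_summable\<close> sums over \<open>{..n}\<close>, which is
    \<open>{..<Suc n}\<close>; hence the instance of \<open>b\<close> at a successor.\<close>
  have "summable (\<lambda>n. (cmod (x n))\<^sup>2)"
    by (rule bounded_imp_summable[where B = "K\<^sup>2"])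
       (use b[of "Suc _"] in \<open>auto simp: lessThan_Suc_atMost\<close>)
  then show x: "x \<in> l2_set" by (simp add: l2_set_def)
  have "(\<Sum>n. (cmod (x n))\<^sup>2) \<le> K\<^sup>2"
    using \<open>summable _\<close> b by (rule suminf_le_const)
  then show "hnorm l2 x \<le> K"
    using K by (simp add: hnorm_l2_eq[OF x] real_le_lsqrt)
qed

lemma cmod_le_hnorm: "x \<in> l2_set \<Longrightarrow> cmod (x n) \<le> hnorm l2 x"
  using member_le_L2_set[of "{..<Suc n}" n "\<lambda>n. cmod (x n)"] L2_set_le_hnorm[of x "Suc n"]
  by simp

text \<open>Each finite section grows at most by the factor K. All operators below are
  multiplications by a sequence, so that operator estimates become bounds on the multiplier that are
  uniform in n.\<close>

lemma l2_mult:
  assumes "x \<in> l2_set" and "\<And>n. cmod (m n) \<le> K"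
  shows "(\<lambda>n. m n * x n) \<in> l2_set" "hnorm l2 (\<lambda>n. m n * x n) \<le> K * hnorm l2 x"
proof -
  have K: "0 \<le> K" using assms(2)[of 0] norm_ge_zero order_trans by blast
  have "L2_set (\<lambda>n. cmod (m n * x n)) {..<N} \<le> K * hnorm l2 x" for N
  proof -
    have "L2_set (\<lambda>n. cmod (m n * x n)) {..<N} \<le> L2_set (\<lambda>n. K * cmod (x n)) {..<N}"
      using assms(2) by (intro L2_set_mono) (auto simp: norm_mult mult_right_mono)
    also have "\<dots> = K * L2_set (\<lambda>n. cmod (x n)) {..<N}"
      using K by (simp add: L2_set_right_distrib)
    also have "\<dots> \<le> K * hnorm l2 x"
      using K assms(1) by (intro mult_left_mono L2_set_le_hnorm)
    finally show ?thesis .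
  qed
  from l2_boundI[OF this]
  show "(\<lambda>n. m n * x n) \<in> l2_set" "hnorm l2 (\<lambda>n. m n * x n) \<le> K * hnorm l2 x" .
qed

text \<open>Minkowski's inequality, passed from finite sections to the whole sequence.\<close>

lemma l2_add:
  assumes "x \<in> l2_set" "y \<in> l2_set"
  shows "(\<lambda>n. x n + y n) \<in> l2_set" "hnorm l2 (\<lambda>n. x n + y n) \<le> hnorm l2 x + hnorm l2 y"
proof -
  have "L2_set (\<lambda>n. cmod (x n + y n)) {..<N} \<le> hnorm l2 x + hnorm l2 y" for N
  proof -
    have "L2_set (\<lambda>n. cmod (x n + y n)) {..<N} \<le> L2_set (\<lambda>n. cmod (x n) + cmod (y n)) {..<N}"
      by (intro L2_set_mono) (auto simp: norm_triangle_ineq)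
    also have "\<dots> \<le> L2_set (\<lambda>n. cmod (x n)) {..<N} + L2_set (\<lambda>n. cmod (y n)) {..<N}"
      by (rule L2_set_triangle_ineq)
    also have "\<dots> \<le> hnorm l2 x + hnorm l2 y"
      by (intro add_mono L2_set_le_hnorm assms)
    finally show ?thesis .
  qed
  from l2_boundI[OF this]
  show "(\<lambda>n. x n + y n) \<in> l2_set" "hnorm l2 (\<lambda>n. x n + y n) \<le> hnorm l2 x + hnorm l2 y" .
qed

lemma l2_scale: "x \<in> l2_set \<Longrightarrow> (\<lambda>n. c * x n) \<in> l2_set"
  by (rule l2_mult(1)[where K = "cmod c"]) auto

lemma l2_zero [simp]: "(\<lambda>n. 0) \<in> l2_set"
  by (simp add: l2_set_def)

lemma l2_uminus: "x \<in> l2_set \<Longrightarrow> (\<lambda>n. - x n) \<in> l2_set"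
  using l2_scale[of x "-1"] by simp

lemma l2_diff: "x \<in> l2_set \<Longrightarrow> y \<in> l2_set \<Longrightarrow> (\<lambda>n. x n - y n) \<in> l2_set"
  using l2_add(1)[of x "\<lambda>n. - y n"] l2_uminus[of y] by simp

section \<open>Subtraction, distance and completeness\<close>

lemma l2_cut_mem [simp]: "l2_cut x \<in> l2_set"
  by (simp add: l2_cut_def)

text \<open>The inverse is a definite description over the carrier, so existence and uniqueness are
  both due. Addition treats a \<open>y\<close> outside \<open>l2_set\<close> as 0, which makes 0 its
  inverse.\<close>

lemma a_inv_l2_cut: "\<ominus>\<^bsub>l2\<^esub> y = (\<lambda>n. - l2_cut y n)"
  unfolding a_inv_def m_inv_def
proof (rule the_equality)
  show "(\<lambda>n. - l2_cut y n) \<in> carrier (add_monoid l2) \<and>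
    y \<otimes>\<^bsub>add_monoid l2\<^esub> (\<lambda>n. - l2_cut y n) = \<one>\<^bsub>add_monoid l2\<^esub> \<and>
    (\<lambda>n. - l2_cut y n) \<otimes>\<^bsub>add_monoid l2\<^esub> y = \<one>\<^bsub>add_monoid l2\<^esub>"
    using l2_uminus[of "l2_cut y"] by (simp add: l2_def)
next
  fix u assume "u \<in> carrier (add_monoid l2) \<and>
    y \<otimes>\<^bsub>add_monoid l2\<^esub> u = \<one>\<^bsub>add_monoid l2\<^esub> \<and>
    u \<otimes>\<^bsub>add_monoid l2\<^esub> y = \<one>\<^bsub>add_monoid l2\<^esub>"
  then have "u \<in> l2_set" "(\<lambda>n. u n + l2_cut y n) = (\<lambda>n. 0)"
    by (auto simp: l2_def)
  then show "u = (\<lambda>n. - l2_cut y n)"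
    by (auto simp: fun_eq_iff eq_neg_iff_add_eq_0)
qed

lemma minus_l2_cut: "x \<ominus>\<^bsub>l2\<^esub> y = (\<lambda>n. l2_cut x n - l2_cut y n)"
  using l2_uminus[of "l2_cut y"] by (simp add: a_minus_def a_inv_l2_cut, simp add: l2_def)

lemma a_inv_l2 [simp]: "y \<in> l2_set \<Longrightarrow> \<ominus>\<^bsub>l2\<^esub> y = (\<lambda>n. - y n)"
  by (simp add: a_inv_l2_cut)

lemma minus_l2 [simp]:
  "x \<in> l2_set \<Longrightarrow> y \<in> l2_set \<Longrightarrow> x \<ominus>\<^bsub>l2\<^esub> y = (\<lambda>n. x n - y n)"
  by (simp add: minus_l2_cut)

lemma hdist_l2:
  "x \<in> l2_set \<Longrightarrow> y \<in> l2_set \<Longrightarrow> hdist l2 x y = hnorm l2 (\<lambda>n. x n - y n)"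
  by (simp add: hdist_def)

text \<open>Transfers nonnegativity from the carrier to arbitrary arguments.\<close>

lemma hdist_l2_cut: "hdist l2 x y = hdist l2 (l2_cut x) (l2_cut y)"
  by (simp add: hdist_def minus_l2_cut)

lemma hnorm_l2_eq_0: 
  assumes "x \<in> l2_set" "hnorm l2 x = 0" shows "x = (\<lambda>n. 0)"
  using cmod_le_hnorm[OF assms(1)] assms(2) by (auto simp: fun_eq_iff)

lemma Metric_space_l2: "Metric_space l2_set (hdist l2)"
proof
  show "0 \<le> hdist l2 x y" for x y
    by (subst hdist_l2_cut) (simp add: hdist_l2 hnorm_l2_nonneg l2_diff)
  show "hdist l2 x y = hdist l2 y x" for x y
    by (simp add: hdist_def minus_l2_cut hnorm_l2 norm_minus_commute)
next
  fix x y assume xy: "x \<in> l2_set" "y \<in> l2_set"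
  show "hdist l2 x y = 0 \<longleftrightarrow> x = y"
    using hnorm_l2_eq_0[OF l2_diff[OF xy]] xy
    by (auto simp: hdist_l2 fun_eq_iff) (simp add: hnorm_l2)
next
  fix x y z assume "x \<in> l2_set" "y \<in> l2_set" "z \<in> l2_set"
  then show "hdist l2 x z \<le> hdist l2 x y + hdist l2 y z"
    using l2_add(2)[of "\<lambda>n. x n - y n" "\<lambda>n. y n - z n"] by (simp add: hdist_l2 l2_diff)
qed

text \<open>Coordinates are dominated by the norm, so a Cauchy sequence has a coordinatewise limit
  \<open>g\<close>. The Cauchy estimate survives the limit on each finite section, hence on the
  whole sequence.\<close>

lemma mcomplete_l2: "Metric_space.mcomplete l2_set (hdist l2)"
proof -
  interpret Metric_space l2_set "hdist l2" by (rule Metric_space_l2)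
  show ?thesis
    unfolding mcomplete_def
  proof (intro allI impI)
    fix f assume "MCauchy f"
    then have f: "\<And>k. f k \<in> l2_set"
      and C: "\<And>e. 0 < e \<Longrightarrow> \<exists>N. \<forall>j k. N \<le> j \<longrightarrow> N \<le> k \<longrightarrow> hdist l2 (f j) (f k) < e"
      by (auto simp: MCauchy_def)
    have le: "cmod (f j n - f k n) \<le> hdist l2 (f j) (f k)" for j k n
      using cmod_le_hnorm[OF l2_diff[OF f f]] by (simp add: hdist_l2 f)
    have "Cauchy (\<lambda>k. f k n)" for n
      unfolding Cauchy_def dist_norm using C le by (meson order_le_less_trans)
    then have "\<exists>l. (\<lambda>k. f k n) \<longlonglongrightarrow> l" for n
      by (simp add: Cauchy_convergent_iff convergent_def)
    then obtain g where g: "(\<lambda>k. f k n) \<longlonglongrightarrow> g n" for n by metis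
    have ev: "\<exists>N. \<forall>j\<ge>N. (\<lambda>n. f j n - g n) \<in> l2_set \<and> hnorm l2 (\<lambda>n. f j n - g n) \<le> e"
      if e: "0 < e" for e
    proof -
      obtain N where N: "\<And>j k. N \<le> j \<Longrightarrow> N \<le> k \<Longrightarrow> hdist l2 (f j) (f k) < e"
        using C[OF e] by blast
      \<comment> \<open>Here j and M are fixed while k tends to infinity; a finite sum commutes with
        this limit.\<close>
      have "L2_set (\<lambda>n. cmod (f j n - g n)) {..<M} \<le> e" if "N \<le> j" for j M
      proof (rule tendsto_upperbound)
        show "(\<lambda>k. L2_set (\<lambda>n. cmod (f j n - f k n)) {..<M})
            \<longlonglongrightarrow> L2_set (\<lambda>n. cmod (f j n - g n)) {..<M}"
          unfolding L2_set_def by (intro tendsto_intros g)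
        show "\<forall>\<^sub>F k in sequentially. L2_set (\<lambda>n. cmod (f j n - f k n)) {..<M} \<le> e"
          using eventually_ge_at_top[of N]
        proof eventually_elim
          case (elim k)
          show ?case
            using L2_set_le_hnorm[OF l2_diff[OF f f], of j k M] N[OF that elim]
            by (simp add: hdist_l2 f)
        qed
      qed simp
      then show ?thesis using l2_boundI[of "\<lambda>n. f _ n - g n" e] by blast
    qed
    obtain N where "(\<lambda>n. f N n - g n) \<in> l2_set" using ev[of 1] by auto
    \<comment> \<open>\<open>g\<close> is \<open>f N\<close> minus the difference
      \<open>f N - g\<close>, both square summable.\<close>
    from l2_diff[OF f[of N] this] have "g \<in> l2_set" by simp
    moreover have "\<exists>N. \<forall>j\<ge>N. hdist l2 (f j) g < e" if "0 < e" for e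
      using ev[of "e/2"] that by (force simp: hdist_l2 f \<open>g \<in> l2_set\<close>)
    ultimately show "\<exists>x. limitin mtopology f x sequentially"
      using f by (auto simp: limit_metric_sequentially)
  qed
qed

section \<open>The inner product\<close>

text \<open>Cauchy-Schwarz on finite sections. It serves twice: the inner product series converges,
  and the observation functional is bounded.\<close>

lemma summable_l2_prod:
  assumes "x \<in> l2_set" "y \<in> l2_set"
  shows "summable (\<lambda>n. cmod (x n) * cmod (y n))"
    and "(\<Sum>n. cmod (x n) * cmod (y n)) \<le> hnorm l2 x * hnorm l2 y"
proof -
  have b: "(\<Sum>n<N. cmod (x n) * cmod (y n)) \<le> hnorm l2 x * hnorm l2 y" for N
  proof -
    have "(\<Sum>n<N. cmod (x n) * cmod (y n))
        \<le> L2_set (\<lambda>n. cmod (x n)) {..<N} * L2_set (\<lambda>n. cmod (y n)) {..<N}"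
      using L2_set_mult_ineq[of "\<lambda>n. cmod (x n)" "\<lambda>n. cmod (y n)" "{..<N}"] by simp
    also have "\<dots> \<le> hnorm l2 x * hnorm l2 y"
      using assms by (intro mult_mono L2_set_le_hnorm) (auto simp: hnorm_l2_nonneg)
    finally show ?thesis .
  qed
  show s: "summable (\<lambda>n. cmod (x n) * cmod (y n))"
    by (rule bounded_imp_summable[where B = "hnorm l2 x * hnorm l2 y"])
       (use b[of "Suc _"] in \<open>auto simp: lessThan_Suc_atMost\<close>)
  show "(\<Sum>n. cmod (x n) * cmod (y n)) \<le> hnorm l2 x * hnorm l2 y"
    using s b by (rule suminf_le_const)
qed

lemma summable_hinner_l2:
  assumes "x \<in> l2_set" "y \<in> l2_set" shows "summable (\<lambda>n. x n * cnj (y n))"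
  by (rule summable_norm_cancel) (use summable_l2_prod(1)[OF assms] in \<open>simp add: norm_mult\<close>)

lemma complex_hilbert_space_l2: "complex_hilbert_space l2"
proof (rule complex_hilbert_space.intro)
  have "abelian_group l2"
  proof (rule abelian_groupI)
    show "\<exists>y\<in>carrier l2. y \<oplus>\<^bsub>l2\<^esub> x = \<zero>\<^bsub>l2\<^esub>" if "x \<in> carrier l2" for x
      using that by (intro bexI[of _ "\<lambda>n. - x n"]) (auto simp: l2_uminus)
  qed (auto simp: l2_add add_ac)
  with cring_from_type_algebra show "module (ring_of_type_algebra :: complex ring) l2"
    by (rule moduleI)
       (simp_all add: ring_of_type_algebra_def l2_scale l2_add(1) distrib_left distrib_right mult.assoc)
  show "complex_hilbert_space_axioms l2"
  proof
    fix x assume x: "x \<in> carrier l2"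
    show "hinner l2 x x = 0 \<Longrightarrow> x = \<zero>\<^bsub>l2\<^esub>"
      using hnorm_l2_eq_0[of x] x by (simp add: hnorm_def)
    show "0 \<le> Re (hinner l2 x x)"
      using hnorm_l2_nonneg[of x] x by (simp add: hnorm_def)
  next
    fix x y assume xy: "x \<in> carrier l2" "y \<in> carrier l2"
    show "hinner l2 (c \<odot>\<^bsub>l2\<^esub> x) y = c * hinner l2 x y" for c
      using summable_hinner_l2[of x y] xy
      by (simp add: hinner_l2 suminf_mult[symmetric] mult.assoc)
    show "hinner l2 y x = cnj (hinner l2 x y)"
      using summable_hinner_l2[of x y] xy
      by (simp add: hinner_l2 bounded_linear.suminf[OF bounded_linear_cnj] mult.commute)
    fix z assume z: "z \<in> carrier l2"
    show "hinner l2 (x \<oplus>\<^bsub>l2\<^esub> y) z = hinner l2 x z + hinner l2 y z"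
      using summable_hinner_l2[of x z] summable_hinner_l2[of y z] xy z
      by (simp add: hinner_l2 suminf_add distrib_right)
  qed (simp add: mcomplete_l2)
qed

section \<open>The diagonal semigroup\<close>

text \<open>The real supremum in \<open>op_norm\<close> is meaningful because the unit ball contains
  0 and the values on it are bounded by K. The lower bound 0 is the value at the zero sequence; it
  completes the sandwich in the proof of holomorphy.\<close>

lemma op_norm_l2_mult:
  assumes S: "\<And>x. x \<in> l2_set \<Longrightarrow> S x = (\<lambda>n. m n * x n)" and m: "\<And>n. cmod (m n) \<le> K"
  shows "0 \<le> op_norm l2 S" "op_norm l2 S \<le> K"
proof -
  have K: "0 \<le> K" using m[of 0] norm_ge_zero order_trans by blast
  have b: "hnorm l2 (S x) \<le> K" if "x \<in> l2_set" "hnorm l2 x \<le> 1" for x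
    using l2_mult(2)[where m = m and K = K, OF that(1) m] mult_left_mono[OF that(2) K] S[OF that(1)] by simp
  have z: "hnorm l2 (\<lambda>n. 0) = 0" by (simp add: hnorm_l2)
  show "op_norm l2 S \<le> K"
    unfolding op_norm_def by (rule cSUP_least) (use b z in \<open>auto intro: exI[of _ "\<lambda>n. 0"]\<close>)
  have "hnorm l2 (S (\<lambda>n. 0)) \<le> op_norm l2 S"
    unfolding op_norm_def by (rule cSUP_upper) (use b z in \<open>auto intro!: bdd_aboveI2\<close>)
  then show "0 \<le> op_norm l2 S" using z by (simp add: S)
qed

lemma l2_divide: "x \<in> l2_set \<Longrightarrow> (\<lambda>n. x n / c) \<in> l2_set"
  using l2_scale[of x "1 / c"] by simp

lemma bounded_operator_l2_mult:
  assumes "\<And>n. cmod (m n) \<le> K"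
  shows "bounded_operator l2 (\<lambda>x n. m n * x n)"
proof -
  have "\<forall>x\<in>l2_set. hnorm l2 (\<lambda>n. m n * x n) \<le> K * hnorm l2 x"
    using l2_mult(2)[where m = m and K = K, OF _ assms] by blast
  then show ?thesis
    using l2_mult(1)[where m = m and K = K, OF _ assms]
    by (auto simp: bounded_operator_def l2_add(1) l2_scale distrib_left mult.left_commute)
qed

text \<open>Each coordinate is dominated by the norm. This is how limits of difference quotients are
  identified.\<close>

lemma l2_lim_coordinate:
  assumes "hlim l2 f y F" "\<And>s. f s \<in> l2_set" "y \<in> l2_set"
  shows "((\<lambda>s. f s n) \<longlongrightarrow> y n) F"
proof (rule Lim_null[THEN iffD2], rule Lim_null_comparison)
  show "((\<lambda>s. hdist l2 (f s) y) \<longlongrightarrow> 0) F" using assms(1) by (simp add: hlim_def)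
  show "\<forall>\<^sub>F s in F. norm (f s n - y n) \<le> hdist l2 (f s) y"
    using cmod_le_hnorm[OF l2_diff[OF assms(2,3)]] by (simp add: hdist_l2 assms)
qed

section \<open>The semigroup generated by the diagonal operator\<close>

text \<open>With the base 16, two factors \<open>(1/2) ^ n\<close>, one from the state and one from
  the functional, turn the eigenvalue into its square root \<open>4 ^ n\<close>. This produces the
  critical size \<open>1 / sqrt t\<close>.\<close>

definition rate :: "nat \<Rightarrow> real" where
  "rate n = 16 ^ n"

text \<open>Time is complex, so the same function is the semigroup and its holomorphic
  extension.\<close>

definition heat :: "complex \<Rightarrow> (nat \<Rightarrow> complex) \<Rightarrow> nat \<Rightarrow> complex" where
  "heat z x = (\<lambda>n. exp (- (of_real (rate n) * z)) * x n)"

lemma rate_ge_1: "1 \<le> rate n"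
  by (simp add: rate_def)

lemma cmod_exp_rate: "cmod (exp (- (of_real (rate n) * z))) = exp (- (rate n * Re z))"
  by simp

lemma cmod_exp_rate_le_1: "0 \<le> Re z \<Longrightarrow> cmod (exp (- (of_real (rate n) * z))) \<le> 1"
  using rate_ge_1[of n] by simp

lemma heat_mem: "0 \<le> Re z \<Longrightarrow> x \<in> l2_set \<Longrightarrow> heat z x \<in> l2_set"
  unfolding heat_def by (rule l2_mult(1)[where K = 1, OF _ cmod_exp_rate_le_1])

lemma bounded_operator_heat: "0 \<le> Re z \<Longrightarrow> bounded_operator l2 (heat z)"
  unfolding heat_def by (rule bounded_operator_l2_mult) (rule cmod_exp_rate_le_1)

lemma heat_add: "heat (z + w) x = heat z (heat w x)"
  by (simp add: heat_def fun_eq_iff distrib_left flip: exp_add mult.assoc)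

lemma heat_0: "heat 0 x = x"
  by (simp add: heat_def)

text \<open>The smallest eigenvalue is 1, so the decay rate is 1.\<close>

lemma op_norm_heat_le:
  assumes "0 \<le> t" shows "op_norm l2 (heat (of_real t)) \<le> exp (- t)"
proof (rule op_norm_l2_mult(2))
  show "cmod (exp (- (of_real (rate n) * of_real t))) \<le> exp (- t)" for n
    using mult_right_mono[OF rate_ge_1 assms, of n] by simp
qed (simp add: heat_def)

text \<open>Dominated convergence for series. The general filter covers both real times decreasing
  to 0 and complex times in a sector, as the multipliers have modulus at most 1 on the closed right
  half-plane.\<close>

lemma heat_tendsto:
  assumes x: "x \<in> l2_set" and g: "(g \<longlongrightarrow> 0) F" and re: "\<forall>\<^sub>F s in F. 0 \<le> Re (g s)"
  shows "hlim l2 (\<lambda>s. heat (g s) x) x F"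
\<comment> \<open>\<open>tannerys_theorem\<close> asks for a proper filter; along \<open>bot\<close>
  every limit holds.\<close>
proof (cases "F = bot")
  case False
  define a where "a n s = (cmod ((exp (- (of_real (rate n) * g s)) - 1) * x n))\<^sup>2" for n s
  \<comment> \<open>The majorant has the factor 4 because the exponential differs from 1 by at most
    2 in modulus.\<close>
  have "((\<lambda>s. suminf (\<lambda>n. a n s)) \<longlongrightarrow> suminf (\<lambda>n::nat. 0::real)) F"
  proof (rule tannerys_theorem[THEN conjunct2, THEN conjunct2])
    show "((\<lambda>s. a n s) \<longlongrightarrow> 0) F" for n
      unfolding a_def by (auto intro!: tendsto_eq_intros g)
    show "\<forall>\<^sub>F (n, s) in sequentially \<times>\<^sub>F F. norm (a n s) \<le> 4 * (cmod (x n))\<^sup>2"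
    proof (rule eventually_mono[OF eventually_prodI[OF eventually_True re]], safe)
      fix n s assume "0 \<le> Re (g (snd (n::nat, s)))"
      then have "cmod (exp (- (of_real (rate n) * g s))) \<le> 1"
        by (intro cmod_exp_rate_le_1) simp
      then have "cmod (exp (- (of_real (rate n) * g s)) - 1) \<le> 2"
        using norm_triangle_ineq4[of "exp (- (of_real (rate n) * g s))" 1]
        unfolding norm_one by linarith
      then have "(cmod (exp (- (of_real (rate n) * g s)) - 1))\<^sup>2 \<le> 2\<^sup>2"
        by (intro power_mono) auto
      then show "norm (a n s) \<le> 4 * (cmod (x n))\<^sup>2"
        by (simp add: a_def norm_mult power_mult_distrib mult_right_mono)
    qed
    show "summable (\<lambda>n. 4 * (cmod (x n))\<^sup>2)"
      using x by (simp add: l2_set_def)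
  qed (rule False)
  then have "((\<lambda>s. sqrt (suminf (\<lambda>n. a n s))) \<longlongrightarrow> sqrt 0) F"
    by (intro tendsto_real_sqrt) simp
  moreover have "\<forall>\<^sub>F s in F. hdist l2 (heat (g s) x) x = sqrt (suminf (\<lambda>n. a n s))"
    using re
  proof eventually_elim
    case (elim s)
    have "heat (g s) x n - x n = (exp (- (of_real (rate n) * g s)) - 1) * x n" for n
      by (simp add: heat_def left_diff_distrib)
    then show ?case
      using hnorm_l2_eq[OF l2_diff[OF heat_mem[OF elim x] x]]
      by (simp add: hdist_l2 heat_mem elim x a_def)
  qed
  ultimately show ?thesis
    unfolding hlim_def by (simp add: tendsto_cong)
qed (simp add: hlim_def)

lemma C0_semigroup_heat: "C0_semigroup l2 (\<lambda>t. heat (of_real t))"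
  unfolding C0_semigroup_def
proof (intro conjI allI ballI impI)
  show "hlim l2 (\<lambda>t. heat (of_real t) x) x (at_right 0)" if "x \<in> carrier l2" for x
  proof (rule heat_tendsto)
    show "((\<lambda>t. complex_of_real t) \<longlongrightarrow> 0) (at_right 0)"
      by (auto intro!: tendsto_eq_intros)
    show "\<forall>\<^sub>F t in at_right 0. 0 \<le> Re (complex_of_real t)"
      by (auto simp: eventually_at_filter)
  qed (use that in simp)
qed (auto simp: bounded_operator_heat heat_add heat_0)

lemma exponentially_stable_heat: "exponentially_stable l2 (\<lambda>t. heat (of_real t))"
  unfolding exponentially_stable_def
  by (intro exI[of _ 1] conjI) (auto simp: op_norm_heat_le)

section \<open>Holomorphy on the right half-plane\<close>

lemma sq_mult_exp_le:
  fixes y :: real assumes "0 \<le> y" shows "y\<^sup>2 * exp (- y) \<le> 2"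
proof -
  have "y\<^sup>2 \<le> 2 * exp y" using exp_lower_Taylor_quadratic[OF assms] assms by simp
  then show ?thesis by (simp add: exp_minus field_simps)
qed

lemma mult_exp_le:
  fixes y :: real shows "y * exp (- y) \<le> 1"
proof -
  have "y \<le> exp y" using exp_ge_add_one_self[of y] by linarith
  then show ?thesis by (simp add: exp_minus field_simps)
qed

text \<open>The derivative is multiplication by the coordinatewise derivative \<open>d\<close>. The
  error of the difference quotient is multiplication by \<open>m h\<close>, a second-order Taylor
  remainder divided by \<open>h\<close>; it is O(h) uniformly in n because the exponential decay
  absorbs the square of the eigenvalue.\<close>

lemma op_holomorphic_heat: "op_holomorphic_on l2 heat {z. 0 < Re z}"
  unfolding op_holomorphic_on_def
proof
  fix z assume "z \<in> {z. 0 < Re z}"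
  then have z: "0 < Re z" by simp
  \<comment> \<open>Half of \<open>Re z\<close>: for \<open>cmod h < r\<close> the point
    \<open>z + h\<close> stays in the half-plane, and half of the decay at \<open>z\<close> is left
    after paying for the growth in \<open>h\<close>.\<close>
  define r where "r = Re z / 2"
  have r: "0 < r" using z by (simp add: r_def)
  define d where "d n = - of_real (rate n) * exp (- (of_real (rate n) * z))" for n
  have "cmod (d n) \<le> 1 / Re z" for n
    using mult_exp_le[of "rate n * Re z"] z rate_ge_1[of n]
    by (simp add: d_def norm_mult field_simps)
  then have L: "bounded_operator l2 (\<lambda>x n. d n * x n)" and d: "\<And>x. x \<in> l2_set \<Longrightarrow> (\<lambda>n. d n * x n) \<in> l2_set"
    by (auto intro: bounded_operator_l2_mult l2_mult(1))
  define S where "S h x = ((1 / h) \<odot>\<^bsub>l2\<^esub> (heat (z + h) x \<ominus>\<^bsub>l2\<^esub> heat z x)) \<ominus>\<^bsub>l2\<^esub> (\<lambda>n. d n * x n)"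
    for h x
  define m where "m h n = exp (- (of_real (rate n) * z)) *
      ((exp (- (of_real (rate n) * h)) - 1 + of_real (rate n) * h) / h)" for h n
  have S: "S h x = (\<lambda>n. m h n * x n)" if "h \<noteq> 0" "cmod h < r" "x \<in> l2_set" for h x
  proof -
    have "0 \<le> Re (z + h)" using that(2) abs_Re_le_cmod[of h] r by (simp add: r_def)
    then have "heat (z + h) x \<in> l2_set" "heat z x \<in> l2_set"
      using z that(3) by (auto intro: heat_mem)
    then show ?thesis using that l2_divide[OF l2_diff[of "heat (z + h) x" "heat z x"], of h]
      by (simp add: S_def d) (simp add: heat_def m_def d_def fun_eq_iff field_simps exp_add[symmetric])
  qed
  have m: "cmod (m h n) \<le> 2 / r\<^sup>2 * cmod h" if "h \<noteq> 0" "cmod h < r" for h n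
  proof -
    have "cmod (exp (- (of_real (rate n) * h)) - 1 + of_real (rate n) * h)
        \<le> exp (rate n * \<bar>Re h\<bar>) * (rate n * cmod h)\<^sup>2"
      using Taylor_exp[of "- (of_real (rate n) * h)" 1] rate_ge_1[of n]
      by (simp add: norm_mult abs_mult power2_eq_square algebra_simps)
    also have "\<dots> \<le> exp (rate n * r) * (rate n * cmod h)\<^sup>2"
      using abs_Re_le_cmod[of h] that rate_ge_1[of n]
      by (intro mult_right_mono) auto
    finally have "cmod (m h n) \<le> exp (- (rate n * Re z)) * (exp (rate n * r) * (rate n * cmod h)\<^sup>2 / cmod h)"
      unfolding m_def norm_mult norm_divide cmod_exp_rate
      by (intro mult_left_mono divide_right_mono) auto
    \<comment> \<open>\<open>Re z\<close> is \<open>2 * r\<close>, so the factor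
      \<open>exp (rate n * r)\<close> cancels half of the exponent.\<close>
    also have "\<dots> = exp (- (rate n * r)) * (rate n)\<^sup>2 * cmod h"
      using that by (simp add: r_def exp_minus power2_eq_square field_simps flip: exp_add)
    also have "\<dots> \<le> 2 / r\<^sup>2 * cmod h"
      using sq_mult_exp_le[of "rate n * r"] r rate_ge_1[of n]
      by (intro mult_right_mono) (auto simp: field_simps)
    finally show ?thesis .
  qed
  have ev: "\<forall>\<^sub>F h in at 0. h \<noteq> 0 \<and> cmod h < r"
    using r by (auto simp: eventually_at intro!: exI[of _ r])
  have "((\<lambda>h. op_norm l2 (S h)) \<longlongrightarrow> 0) (at 0)"
  proof (rule tendsto_sandwich)
    show "\<forall>\<^sub>F h in at 0. 0 \<le> op_norm l2 (S h)"
      using ev by eventually_elim (rule op_norm_l2_mult(1)[OF S m], auto)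
    show "\<forall>\<^sub>F h in at 0. op_norm l2 (S h) \<le> 2 / r\<^sup>2 * cmod h"
      using ev by eventually_elim (rule op_norm_l2_mult(2)[OF S m], auto)
    show "((\<lambda>h. 2 / r\<^sup>2 * cmod h) \<longlongrightarrow> 0) (at 0)"
      using r by (auto intro!: tendsto_eq_intros)
  qed simp
  with L show "\<exists>L. bounded_operator l2 L \<and>
      ((\<lambda>h. op_norm l2 (\<lambda>x. ((1 / h) \<odot>\<^bsub>l2\<^esub> (heat (z + h) x \<ominus>\<^bsub>l2\<^esub> heat z x)) \<ominus>\<^bsub>l2\<^esub> L x))
        \<longlongrightarrow> 0) (at 0)"
    unfolding S_def by blast
qed

lemma sector_half_pi: "sector (pi / 2) = {z. 0 < Re z}"
  unfolding sector_def Arg_Re_pos by auto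

lemma analytic_semigroup_heat: "analytic_semigroup l2 (\<lambda>t. heat (of_real t))"
  unfolding analytic_semigroup_def
proof (intro conjI exI[of _ "pi / 2"] exI[of _ heat] allI impI ballI)
  fix \<delta>' x assume "0 < \<delta>' \<and> \<delta>' < pi / 2" "x \<in> carrier l2"
  then have "sector \<delta>' \<subseteq> sector (pi / 2)" and x: "x \<in> l2_set"
    by (auto simp: sector_def)
  then have "\<forall>\<^sub>F z in at 0 within sector \<delta>'. 0 \<le> Re z"
    by (auto simp: eventually_at_filter sector_half_pi subset_iff less_imp_le)
  then show "hlim l2 (\<lambda>z. heat z x) x (at 0 within sector \<delta>')"
    by (intro heat_tendsto x) auto
qed (auto simp: C0_semigroup_heat bounded_operator_heat heat_add sector_half_pi op_holomorphic_heat)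

section \<open>The generator\<close>

lemma difference_quotient_heat:
  assumes "x \<in> l2_set" "0 \<le> t"
  shows "difference_quotient l2 (\<lambda>t. heat (of_real t)) x t
    = (\<lambda>n. of_real ((exp (- (rate n * t)) - 1) / t) * x n)"
  using assms by (simp add: difference_quotient_def heat_mem)
    (simp add: heat_def fun_eq_iff left_diff_distrib diff_divide_distrib flip: exp_of_real)

text \<open>The domain in \<open>is_generator\<close> consists of the \<open>x\<close> for which the
  limit exists, so the generator is known once every such limit is identified. In each coordinate it
  is the derivative of an exponential at 0.\<close>

lemma generator_heat_unique:
  assumes x: "x \<in> l2_set" and y: "y \<in> l2_set"
    and lim: "hlim l2 (difference_quotient l2 (\<lambda>t. heat (of_real t)) x) y (at_right 0)"
  shows "y n = - (of_real (rate n) * x n)"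
proof (rule tendsto_unique)
  let ?q = "difference_quotient l2 (\<lambda>t. heat (of_real t)) x"
  have q: "?q t = (\<lambda>n. of_real ((exp (- (rate n * t)) - 1) / t) * x n)" if "0 < t" for t
    using difference_quotient_heat[OF x] that by simp
  have ev: "\<forall>\<^sub>F t in at_right (0::real). 0 < t" by (simp add: eventually_at_filter)
  have mem: "?q t \<in> l2_set" if "0 < t" for t
    using l2_divide[OF l2_diff[OF heat_mem[OF _ x] x]] that x
    by (simp add: difference_quotient_def heat_mem)
  \<comment> \<open>\<open>l2_lim_coordinate\<close> wants square summable values for every
    \<open>t\<close>. The filler \<open>y\<close> at \<open>t \<le> 0\<close> does not affect a
    limit from the right.\<close>
  let ?p = "\<lambda>t. if 0 < t then ?q t else y"
  have "hlim l2 ?p y (at_right 0)"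
    using lim unfolding hlim_def
    by (rule Lim_transform_eventually) (use ev in eventually_elim, simp)
  then have "((\<lambda>t. ?p t n) \<longlongrightarrow> y n) (at_right 0)"
    by (rule l2_lim_coordinate) (use mem y in auto)
  then show "((\<lambda>t. of_real ((exp (- (rate n * t)) - 1) / t) * x n) \<longlongrightarrow> y n) (at_right 0)"
    by (rule Lim_transform_eventually) (use ev in eventually_elim, simp add: q)
  have "((\<lambda>t. exp (- (rate n * t))) has_real_derivative - rate n) (at 0)"
    by (auto intro!: derivative_eq_intros)
  then have "((\<lambda>t. (exp (- (rate n * t)) - 1) / t) \<longlongrightarrow> - rate n) (at 0)"
    by (simp add: has_field_derivative_iff)
  then have "((\<lambda>t. (exp (- (rate n * t)) - 1) / t) \<longlongrightarrow> - rate n) (at_right 0)"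
    by (rule filterlim_mono) (auto simp: at_le)
  then have "((\<lambda>t. of_real ((exp (- (rate n * t)) - 1) / t) * x n) \<longlongrightarrow> of_real (- rate n) * x n) (at_right 0)"
    by (intro tendsto_intros)
  then show "((\<lambda>t. of_real ((exp (- (rate n * t)) - 1) / t) * x n) \<longlongrightarrow> - (of_real (rate n) * x n)) (at_right 0)"
    by simp
qed simp

section \<open>Functions outside the Lorentz spaces\<close>

text \<open>If the integral had a finite value \<open>r\<close>, a compact subinterval with
  logarithmic length \<open>r + 1\<close> would already exceed it.\<close>

lemma nn_integral_inverse_eq_top:
  assumes a: "0 < (a::real)"
  shows "(\<integral>\<^sup>+t\<in>{0<..<a}. ennreal (1 / t) \<partial>lborel) = \<infinity>"
proof (rule ccontr)
  let ?I = "\<integral>\<^sup>+t\<in>{0<..<a}. ennreal (1 / t) \<partial>lborel"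
  assume "?I \<noteq> \<infinity>"
  then obtain r where r: "0 \<le> r" "?I = ennreal r" by (cases ?I) auto
  \<comment> \<open>Halving \<open>a\<close> puts the closed interval from \<open>e\<close> to
    \<open>b\<close> inside the open one; \<open>e\<close> is chosen so that
    \<open>ln b - ln e = r + 1\<close>.\<close>
  define b e where "b = a / 2" and "e = b * exp (- (r + 1))"
  have e: "0 < e" "e \<le> b" "b < a" using a r(1) by (auto simp: b_def e_def)
  have "ln b - ln e = r + 1" using a by (simp add: e_def b_def ln_mult ln_div)
  moreover have "(\<integral>\<^sup>+t. ennreal (1 / t) * indicator {e..b} t \<partial>lborel) = ln b - ln e"
    by (rule nn_integral_FTC_Icc) (use e in \<open>auto intro!: derivative_eq_intros simp: has_real_derivative_iff_has_vector_derivative[symmetric]\<close>)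
  moreover have "(\<integral>\<^sup>+t. ennreal (1 / t) * indicator {e..b} t \<partial>lborel) \<le> ?I"
    by (intro nn_integral_mono) (use e in \<open>auto simp: indicator_def\<close>)
  ultimately show False using r by simp
qed

text \<open>For \<open>s < c / sqrt t\<close> the lower bound on \<open>f\<close> forces modulus
  above \<open>s\<close> on an interval longer than \<open>t\<close>, so such an \<open>s\<close>
  does not compete in the infimum.\<close>

lemma rearrangement_ge:
  assumes f: "f \<in> borel_measurable (lebesgue_on {0<..<\<tau>})" and c: "0 < c" and a: "a \<le> \<tau>"
    and low: "\<And>t. 0 < t \<Longrightarrow> t < a \<Longrightarrow> c / sqrt t \<le> cmod (f t)"
    and t: "0 < t" "t < a"
  shows "ennreal (c / sqrt t) \<le> rearrangement (lebesgue_on {0<..<\<tau>}) f t"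
  unfolding rearrangement_def
proof (rule Inf_greatest, clarify)
  fix s :: real
  assume s: "0 < s" and d: "distribution_function (lebesgue_on {0<..<\<tau>}) f s \<le> ennreal t"
  show "ennreal (c / sqrt t) \<le> ennreal s"
  proof (rule ccontr)
    assume "\<not> ?thesis"
    then have less: "s < c / sqrt t" by (meson ennreal_leI not_le)
    \<comment> \<open>\<open>(c / s)\<^sup>2\<close> is the point where \<open>c / sqrt u\<close>
      drops to \<open>s\<close>; the lower bound on \<open>f\<close> is available only below
      \<open>a\<close>.\<close>
    define b where "b = min a ((c / s)\<^sup>2)"
    have "sqrt t < c / s"
      using less s t by (simp add: field_simps)
    then have "t < (c / s)\<^sup>2"
      using t by (metis real_sqrt_less_iff real_sqrt_unique less_imp_le order.strict_trans1 real_sqrt_ge_zero)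
    then have tb: "t < b" using t by (simp add: b_def)
    have sub: "{0<..<b} \<subseteq> {u \<in> space (lebesgue_on {0<..<\<tau>}). s < cmod (f u)}"
    proof
      fix u assume "u \<in> {0<..<b}"
      then have u: "0 < u" "u < a" "u < (c / s)\<^sup>2" by (auto simp: b_def)
      have "sqrt u < c / s" using u(3) s c by (simp add: real_less_lsqrt)
      then have "s < c / sqrt u" using u(1) s by (simp add: field_simps)
      also have "\<dots> \<le> cmod (f u)" using low u by simp
      finally show "u \<in> {u \<in> space (lebesgue_on {0<..<\<tau>}). s < cmod (f u)}"
        using u a by simp
    qed
    have "ennreal b = emeasure (lebesgue_on {0<..<\<tau>}) {0<..<b}"
      using tb t a by (subst emeasure_restrict_space) (auto simp: b_def)
    also have "\<dots> \<le> distribution_function (lebesgue_on {0<..<\<tau>}) f s"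
      unfolding distribution_function_def using f by (intro emeasure_mono sub) measurable
    also note d
    finally show False using tb t by (simp add: ennreal_le_iff)
  qed
qed

lemma ennpowr_mono:
  assumes "x \<le> y" "0 \<le> p" shows "ennpowr x p \<le> ennpowr y p"
proof (cases "y = \<infinity>")
  case False
  then have "enn2real x \<le> enn2real y" "x \<noteq> \<infinity>"
    using assms(1) by (auto intro!: enn2real_mono simp: less_top top_unique)
  then show ?thesis
    using False assms(2) by (auto simp: ennpowr_def intro!: ennreal_leI powr_mono2)
qed (simp add: ennpowr_def)

text \<open>The integrand of the norm is at least \<open>c powr q / t\<close> near 0, which is not
  integrable for any \<open>q\<close>.\<close>

lemma not_in_lorentz2:
  assumes c: "0 < c" and a: "0 < a" "a \<le> \<tau>" and q: "0 < q"
    and low: "\<And>t. 0 < t \<Longrightarrow> t < a \<Longrightarrow> c / sqrt t \<le> cmod (f t)"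
  shows "f \<notin> lorentz2 (lebesgue_on {0<..<\<tau>}) q"
proof
  let ?M = "lebesgue_on {0<..<\<tau>}"
  let ?I = "\<integral>\<^sup>+t\<in>{0<..}. ennpowr (ennreal (t powr (1/2)) * rearrangement ?M f t) q / ennreal t \<partial>lborel"
  assume "f \<in> lorentz2 ?M q"
  \<comment> \<open>The assumed membership supplies the measurability that
    \<open>rearrangement_ge\<close> asks for.\<close>
  then have f: "f \<in> borel_measurable ?M" and fin: "ennpowr ?I (1 / q) < \<infinity>"
    by (auto simp: lorentz2_def lorentz2_norm_def)
  have le: "ennreal (c powr q) * ennreal (1 / t)
      \<le> ennpowr (ennreal (t powr (1/2)) * rearrangement ?M f t) q / ennreal t"
    if t: "0 < t" "t < a" for t
  proof -
    have "ennreal c = ennreal (t powr (1/2)) * ennreal (c / sqrt t)"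
      using t c by (simp add: ennreal_mult[symmetric] powr_half_sqrt)
    also have "\<dots> \<le> ennreal (t powr (1/2)) * rearrangement ?M f t"
      by (intro mult_left_mono rearrangement_ge[where a = a] f c a(2) low t zero_le)
    finally have "ennpowr (ennreal c) q \<le> ennpowr (ennreal (t powr (1/2)) * rearrangement ?M f t) q"
      using q by (intro ennpowr_mono) auto
    moreover have "ennpowr (ennreal c) q = ennreal (c powr q)"
      using c by (simp add: ennpowr_def)
    ultimately have "ennreal (c powr q) / ennreal t
        \<le> ennpowr (ennreal (t powr (1/2)) * rearrangement ?M f t) q / ennreal t"
      by (simp add: divide_right_mono_ennreal)
    then show ?thesis
      using t by (simp add: divide_ennreal ennreal_mult[symmetric])
  qed
  have "(\<integral>\<^sup>+t. ennreal (c powr q) * (ennreal (1 / t) * indicator {0<..<a} t) \<partial>lborel) \<le> ?I"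
    by (intro nn_integral_mono) (use le in \<open>auto simp: indicator_def\<close>)
  moreover have "(\<integral>\<^sup>+t. ennreal (c powr q) * (ennreal (1 / t) * indicator {0<..<a} t) \<partial>lborel)
      = ennreal (c powr q) * \<infinity>"
    using nn_integral_inverse_eq_top[OF a(1)] by (subst nn_integral_cmult) auto
  moreover have "ennreal (c powr q) * \<infinity> = \<infinity>"
    using c by (simp add: ennreal_mult_top)
  ultimately have "?I = \<infinity>" by (simp add: top_unique)
  then show False using fin by (simp add: ennpowr_def)
qed

section \<open>The observed orbit\<close>

text \<open>Factored as the pairing of the diagonal operator's value at \<open>x\<close> with a
  fixed square summable sequence, so that Cauchy-Schwarz bounds it by the graph norm.\<close>

definition observe :: "(nat \<Rightarrow> complex) \<Rightarrow> complex" where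
  "observe x = (\<Sum>n. of_real ((1/2) ^ n) * (of_real (rate n) * x n))"

text \<open>It has two roles: the initial state, and the vector against which \<open>observe\<close>
  pairs the operator's value.\<close>

definition geometric :: "nat \<Rightarrow> complex" where
  "geometric n = of_real ((1/2) ^ n)"

lemma geometric_mem: "geometric \<in> l2_set"
proof -
  have "(cmod (geometric n))\<^sup>2 = (1 / 4) ^ n" for n
    by (simp add: geometric_def norm_power norm_divide power_divide power2_eq_square
        flip: power_mult_distrib)
  then show ?thesis by (simp add: l2_set_def summable_geometric)
qed

lemma observe_bounded:
  assumes "(\<lambda>n. of_real (rate n) * x n) \<in> l2_set"
  shows "summable (\<lambda>n. of_real ((1/2) ^ n) * (of_real (rate n) * x n))"
    and "cmod (observe x) \<le> hnorm l2 geometric * hnorm l2 (\<lambda>n. of_real (rate n) * x n)"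
proof -
  have n: "norm (of_real ((1/2) ^ n) * (of_real (rate n) * x n))
      = cmod (geometric n) * cmod (of_real (rate n) * x n)" for n
    by (simp add: norm_mult geometric_def)
  have s: "summable (\<lambda>n. norm (of_real ((1/2) ^ n) * (of_real (rate n) * x n)))"
    unfolding n by (rule summable_l2_prod(1)[OF geometric_mem assms])
  then show "summable (\<lambda>n. of_real ((1/2) ^ n) * (of_real (rate n) * x n))"
    by (rule summable_norm_cancel)
  show "cmod (observe x) \<le> hnorm l2 geometric * hnorm l2 (\<lambda>n. of_real (rate n) * x n)"
    unfolding observe_def using summable_norm[OF s] summable_l2_prod(2)[OF geometric_mem assms]
    by (simp only: n)
qed

text \<open>All terms of the series are positive, so a single one bounds it from below. For
  \<open>16 ^ n \<le> 1 / t < 16 ^ Suc n\<close> the exponential is at least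
  \<open>exp (- 1)\<close> and \<open>4 ^ n\<close> is at least
  \<open>1 / (4 * sqrt t)\<close>.\<close>

lemma observe_heat_ge:
  assumes t: "0 < t" "t < 1"
  shows "exp (- 1) / 4 / sqrt t \<le> cmod (observe (heat (of_real t) geometric))"
proof -
  define g where "g n = (4::real) ^ n * exp (- (rate n * t))" for n
  have four: "(4::real) ^ n = (1/2) ^ n * (rate n * (1/2) ^ n)" for n
    by (simp add: rate_def flip: power_mult_distrib)
  have "observe (heat (of_real t) geometric) = (\<Sum>n. of_real (g n))"
    unfolding observe_def g_def four by (simp add: heat_def geometric_def exp_of_real[symmetric] mult_ac)
  \<comment> \<open>By \<open>mult_exp_le\<close> the exponential is at most
    \<open>1 / (rate n * t)\<close>, which leaves a geometric series of ratio 1/4.\<close>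
  moreover have g: "summable g"
  proof (rule summable_comparison_test', rule summable_mult)
    show "summable (\<lambda>n. (1 / 4 :: real) ^ n)" by (rule summable_geometric) simp
    show "norm (g n) \<le> 1 / t * (1 / 4) ^ n" for n
    proof -
      have "rate n = 4 ^ n * 4 ^ n" by (simp add: rate_def flip: power_mult_distrib)
      then show ?thesis
        using mult_exp_le[of "rate n * t"] t by (simp add: g_def field_simps power_divide)
    qed
  qed
  ultimately have "observe (heat (of_real t) geometric) = of_real (suminf g)"
    by (simp add: suminf_of_real)
  then have ge: "g n \<le> cmod (observe (heat (of_real t) geometric))" for n
    using sum_le_suminf[OF g, of "{n}"] by (auto simp: g_def)
  \<comment> \<open>The least exponent exceeding \<open>1 / t\<close> is positive because
    \<open>t < 1\<close>; its predecessor is the wanted \<open>n\<close>.\<close>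
  obtain m where "1 / t < 16 ^ m" using real_arch_pow[of 16 "1 / t"] by auto
  moreover have "\<not> 1 / t < 16 ^ 0" using t by simp
  ultimately obtain n where "\<forall>i\<le>n. \<not> 1 / t < 16 ^ i" and n': "1 / t < 16 ^ Suc n"
    using ex_least_nat_less[of "\<lambda>i. 1 / t < 16 ^ i" m] by blast
  then have n: "16 ^ n \<le> 1 / t" by (simp add: not_less)
  have "1 / sqrt t = sqrt (1 / t)" by (simp add: real_sqrt_divide)
  also have "\<dots> \<le> sqrt (16 ^ Suc n)" by (rule real_sqrt_le_mono) (use n' in simp)
  also have "(16::real) ^ Suc n = (4 * 4 ^ n)\<^sup>2"
    by (simp add: power2_eq_square mult_ac flip: power_mult_distrib)
  also have "sqrt \<dots> = 4 * 4 ^ n" by (rule real_sqrt_unique) auto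
  finally have "1 / sqrt t / 4 \<le> 4 ^ n" by simp
  moreover have "exp (- 1) \<le> exp (- (rate n * t))"
    using n t by (simp add: rate_def field_simps)
  ultimately have "1 / sqrt t / 4 * exp (- 1) \<le> g n"
    unfolding g_def using t by (intro mult_mono) auto
  then show ?thesis using ge[of n] by (simp add: field_simps)
qed

theorem theorem2p4:
  shows "\<exists>(H :: (nat \<Rightarrow> complex) hilbert_space) T D A C x.
    complex_hilbert_space H \<and>
    analytic_semigroup H T \<and> exponentially_stable H T \<and>
    is_generator H T D (\<lambda>y. \<ominus>\<^bsub>H\<^esub> A y) \<and> A \<in> D \<rightarrow> carrier H \<and>
    observation_functional H D A C \<and>
    x \<in> carrier H \<and>
    (\<forall>q::real. \<forall>\<tau>::real. 1 \<le> q \<and> 0 < \<tau> \<longrightarrow>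
       (\<lambda>t. C (T t x)) \<notin> lorentz2 (lebesgue_on {0<..<\<tau>}) q)"
proof -
  let ?T = "\<lambda>t. heat (complex_of_real t)"
  let ?A = "\<lambda>x n. of_real (rate n) * x n :: complex"
  \<comment> \<open>Copied from \<open>is_generator\<close>, so the condition on the domain is
    reflexivity, and every element comes with a limit to which \<open>generator_heat_unique\<close>
    applies.\<close>
  let ?D = "{x \<in> carrier l2. \<exists>y\<in>carrier l2. hlim l2 (difference_quotient l2 ?T x) y (at_right 0)}"
  have D: "x \<in> l2_set" "?A x \<in> l2_set"
      "hlim l2 (difference_quotient l2 ?T x) (\<ominus>\<^bsub>l2\<^esub> ?A x) (at_right 0)" if D: "x \<in> ?D" for x
  proof -
    from D obtain y where x: "x \<in> l2_set" and y: "y \<in> l2_set"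
      and lim: "hlim l2 (difference_quotient l2 ?T x) y (at_right 0)" by auto
    have eq: "y = (\<lambda>n. - ?A x n)"
      using generator_heat_unique[OF x y lim] by (simp add: fun_eq_iff)
    show "x \<in> l2_set" by (rule x)
    show A: "?A x \<in> l2_set" using l2_uminus[OF y] by (simp add: eq)
    show "hlim l2 (difference_quotient l2 ?T x) (\<ominus>\<^bsub>l2\<^esub> ?A x) (at_right 0)"
      using lim A by (simp add: eq)
  qed
  have "is_generator l2 ?T ?D (\<lambda>y. \<ominus>\<^bsub>l2\<^esub> ?A y)"
    unfolding is_generator_def using D(2,3) l2_uminus by (intro conjI refl ballI) simp_all
  moreover have "observation_functional l2 ?D ?A observe"
    unfolding observation_functional_def
  proof (intro conjI ballI allI exI)
    fix x assume x: "x \<in> ?D"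
    note sx = observe_bounded(1)[OF D(2)[OF x]]
    show "observe (c \<odot>\<^bsub>l2\<^esub> x) = c * observe x" for c
      using suminf_mult[OF sx, of c] by (simp add: observe_def mult_ac)
    have "hnorm l2 geometric * hnorm l2 (?A x) \<le> hnorm l2 geometric * (hnorm l2 x + hnorm l2 (?A x))"
      using hnorm_l2_nonneg[OF geometric_mem] hnorm_l2_nonneg[OF D(1)[OF x]]
      by (intro mult_left_mono) auto
    then show "cmod (observe x) \<le> hnorm l2 geometric * (hnorm l2 x + hnorm l2 (?A x))"
      using observe_bounded(2)[OF D(2)[OF x]] by linarith
    fix y assume y: "y \<in> ?D"
    show "observe (x \<oplus>\<^bsub>l2\<^esub> y) = observe x + observe y"
      using suminf_add[OF sx observe_bounded(1)[OF D(2)[OF y]]] D(1)[OF x] D(1)[OF y]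
      by (simp add: observe_def distrib_left)
  qed
  moreover have "(\<lambda>t. observe (?T t geometric)) \<notin> lorentz2 (lebesgue_on {0<..<\<tau>}) q"
    if "1 \<le> q \<and> 0 < \<tau>" for q \<tau> :: real
  \<comment> \<open>\<open>observe_heat_ge\<close> works below 1, and the interval of the Lorentz
    space ends at \<open>\<tau>\<close>.\<close>
  proof (rule not_in_lorentz2[where c = "exp (- 1) / 4" and a = "min 1 \<tau>"])
    show "exp (- 1) / 4 / sqrt t \<le> cmod (observe (?T t geometric))" if "0 < t" "t < min 1 \<tau>" for t
      using that by (intro observe_heat_ge) auto
  qed (use that in auto)
  moreover have "?A \<in> ?D \<rightarrow> carrier l2" using D(2) by simp
  ultimately show ?thesis
    using complex_hilbert_space_l2 analytic_semigroup_heat exponentially_stable_heat geometric_mem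
    by (intro exI[of _ l2] exI[of _ ?T] exI[of _ ?D] exI[of _ ?A] exI[of _ observe]
        exI[of _ geometric] conjI allI impI) (assumption | simp only: carrier_l2 | blast)+
qed

end
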